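(* Let $(A,* )$ be a finite dimensional unital commutative associative algebra over $\mathbb{C}$ with identity $\hat{1}$ such that $\dim A\geq 2$. Let $B$ be a vertex $A$-algebroid that is not a Lie algebra. Assume that there exist $e,f,h\in B$ such that $e_0f=h$, $h_0e=2e$, $h_0f=-2f$, $h_0h=0$, that $\mathrm{Span}\{e,f,h\}$ is a Lie algebra isomorphic to $sl_2$, that $A=\mathbb{C}\hat{1}\oplus\bigoplus_{i=1}^t N^i$ where the $N^i$ are irreducible $sl_2$-modules, and that $\left(\bigoplus_{i=1}^t N^i\right)\cdot B\subseteq\partial(A)$. Put $N=\bigoplus_{i=1}^tN^i$. For each $i\in\{1,\dots,t\}$ let $a^i_0$ be a highest weight vector of $N^i$, of weight $m_i$, and set $a^i_j=\frac{1}{j!}(f_0)^ja^i_0$, so that $\{a^i_0,\dots,a^i_{m_i}\}$ is a basis of $N^i$ and $h_0a^i_j=(m_i-2j)a^i_j$, $f_0a^i_j=(j+1)a^i_{j+1}$, $e_0a^i_j=(m_i-j+1)a^i_{j-1}$ (with $a^i_{-1}=a^i_{m_i+1}=0$). If $e_1f=k\hat{1}$ with $k\in\mathbb{C}$, $k\neq 0$, then: (i) $\mathrm{Ker}(\partial)=\mathbb{C}\hat{1}$. (ii) Each $N^i$ is an irreducible $sl_2$-module of dimension $2$, and $A$ is a local algebra. In addition, for $i,j\in\{1,\dots,t\}$ and $s,r\in\{0,1\}$: \begin{align*} & a^i_s*a^j_r=0,\\ & a^i_0\cdot e=0,\quad a^i_1\cdot e=\partial(a^i_0),\\ & a^i_0\cdot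 f=\partial(a^i_1),\quad a^i_1\cdot f=0,\\ & a^i_0\cdot h=\partial(a^i_0),\quad a^i_1\cdot h=-\partial(a^i_1),\\ & a^i_s\cdot\partial(a^j_r)=0,\\ & \partial(a^i_s)_1e=e_0a^i_s=(2-s)a^i_{s-1},\\ & \partial(a^i_s)_1f=f_0a^i_s=(s+1)a^i_{s+1},\quad \partial(a^i_s)_1h=h_0a^i_s=(1-2s)a^i_s,\quad k=1. \end{align*} (iii) For $a,a'\in N$ we have $a\cdot e=\partial(e_0a)$, $a\cdot f=\partial(f_0a)$, $a\cdot h=\partial(h_0a)$, $a\cdot\partial(a')=0$.
   Context: A left Leibniz algebra is a complex vector space with a bilinear bracket satisfying $[a,[b,c]]=[[a,b],c]+[b,[a,c]]$. Let $(A,* )$ be a unital commutative associative $\mathbb{C}$-algebra with identity $\hat1$. A vertex $A$-algebroid is a complex vector space $B$ with: a bilinear map $A\times B\to B$, $(a,v)\mapsto a\cdot v$, with $\hat1\cdot v=v$ (not required to be associative); a left Leibniz bracket on $B$, written $u_0v=[u,v]$; a homomorphism of Leibniz algebras $B\to\mathrm{Der}(A)$, written $u\mapsto(a\mapsto u_0a)$; a symmetric bilinear pairing $B\times B\to A$, written $(u,v)\mapsto u_1v$; and a linear map $\partial:A\to B$ with $\partial(a)_0a'=0$ for all $a,a'\in A$; such that for all $a,a'\in A$, $u,v,v^1,v^2\in B$: $a\cdot(a'\cdot v)-(a*a')\cdot v=(v_0a)\cdot\partial(a')+(v_0a')\cdot\partial(a)$; $u_0(a\cdot v)=(u_0a)\cdot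 v+a\cdot(u_0v)$; $u_0v+v_0u=\partial(u_1v)$; $(a\cdot v)_0a'=a*(v_0a')$; $(a\cdot u)_1v=a*(u_1v)-u_0v_0a$; $v_0(v^1{}_1v^2)=(v_0v^1)_1v^2+v^1{}_1(v_0v^2)$; $\partial(a*a')=a\cdot\partial(a')+a'\cdot\partial(a)$; $v_0\partial(a)=\partial(v_0a)$; $v_1\partial(a)=v_0a$. "$B$ is not a Lie algebra" refers to the bracket $u_0v$. The copy of $sl_2$ spanned by $e,f,h$ acts on $A$ by $a\mapsto u_0a$; $\mathbb{C}\hat1$ is a trivial submodule. For a subspace $N\subseteq A$, $N\cdot B=\mathrm{Span}\{n\cdot b\mid n\in N,b\in B\}$. *)

theory Defs
  imports "HOL-Analysis.Analysis"
begin

definition bilinear_map ::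
  "(complex \<Rightarrow> 'u::ab_group_add \<Rightarrow> 'u) \<Rightarrow> (complex \<Rightarrow> 'v::ab_group_add \<Rightarrow> 'v) \<Rightarrow>
   (complex \<Rightarrow> 'w::ab_group_add \<Rightarrow> 'w) \<Rightarrow> ('u \<Rightarrow> 'v \<Rightarrow> 'w) \<Rightarrow> bool" where
  "bilinear_map sU sV sW \<beta> \<longleftrightarrow>
     (\<forall>x. Vector_Spaces.linear sV sW (\<beta> x)) \<and>
     (\<forall>y. Vector_Spaces.linear sU sW (\<lambda>x. \<beta> x y))"

locale left_leibniz_algebra =
  fixes smul :: "complex \<Rightarrow> 'b::ab_group_add \<Rightarrow> 'b"
    and bracket :: "'b \<Rightarrow> 'b \<Rightarrow> 'b"
  assumes bilinear_bracket: "bilinear_map smul smul smul bracket"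
    and left_leibniz:
      "bracket a (bracket b c) = bracket (bracket a b) c + bracket b (bracket a c)"

text \<open>A Lie algebra whose underlying space is a subspace \<open>L\<close> of the ambient type.\<close>

definition lie_algebra_on ::
  "(complex \<Rightarrow> 'b::ab_group_add \<Rightarrow> 'b) \<Rightarrow> ('b \<Rightarrow> 'b \<Rightarrow> 'b) \<Rightarrow> 'b set \<Rightarrow> bool" where
  "lie_algebra_on smul bracket L \<longleftrightarrow>
     vector_space smul \<and> module.subspace smul L \<and>
     (\<forall>x\<in>L. \<forall>y\<in>L. bracket x y \<in> L) \<and>
     (\<forall>x\<in>L. \<forall>y\<in>L. \<forall>z\<in>L. bracket (x + y) z = bracket x z + bracket y z) \<and>
     (\<forall>x\<in>L. \<forall>y\<in>L. \<forall>z\<in>L. bracket x (y + z) = bracket x y + bracket x z) \<and>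
     (\<forall>c. \<forall>x\<in>L. \<forall>y\<in>L. bracket (smul c x) y = smul c (bracket x y)) \<and>
     (\<forall>c. \<forall>x\<in>L. \<forall>y\<in>L. bracket x (smul c y) = smul c (bracket x y)) \<and>
     (\<forall>x\<in>L. bracket x x = 0) \<and>
     (\<forall>x\<in>L. \<forall>y\<in>L. \<forall>z\<in>L.
        bracket x (bracket y z) + bracket y (bracket z x) + bracket z (bracket x y) = 0)"

definition lie_isomorphic ::
  "(complex \<Rightarrow> 'b::ab_group_add \<Rightarrow> 'b) \<Rightarrow> ('b \<Rightarrow> 'b \<Rightarrow> 'b) \<Rightarrow> 'b set \<Rightarrow>
   (complex \<Rightarrow> 'c::ab_group_add \<Rightarrow> 'c) \<Rightarrow> ('c \<Rightarrow> 'c \<Rightarrow> 'c) \<Rightarrow> 'c set \<Rightarrow> bool" where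
  "lie_isomorphic s1 br1 L1 s2 br2 L2 \<longleftrightarrow>
     (\<exists>\<phi>. bij_betw \<phi> L1 L2 \<and>
        (\<forall>x\<in>L1. \<forall>y\<in>L1. \<phi> (x + y) = \<phi> x + \<phi> y) \<and>
        (\<forall>c. \<forall>x\<in>L1. \<phi> (s1 c x) = s2 c (\<phi> x)) \<and>
        (\<forall>x\<in>L1. \<forall>y\<in>L1. \<phi> (br1 x y) = br2 (\<phi> x) (\<phi> y)))"

definition sl2 :: "(complex^2^2) set" where
  "sl2 = {M. trace M = 0}"

definition matrix_scale :: "complex \<Rightarrow> complex^2^2 \<Rightarrow> complex^2^2" where
  "matrix_scale c M = (\<chi> i j. c * M $ i $ j)"

definition matrix_commutator :: "complex^2^2 \<Rightarrow> complex^2^2 \<Rightarrow> complex^2^2" where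
  "matrix_commutator M M' = M ** M' - M' ** M"

locale comm_algebra = vector_space smul
  for smul :: "complex \<Rightarrow> 'a::comm_ring_1 \<Rightarrow> 'a" +
  assumes scale_mult_left: "smul c x * y = smul c (x * y)"

definition finite_dimensional :: "(complex \<Rightarrow> 'a::ab_group_add \<Rightarrow> 'a) \<Rightarrow> bool" where
  "finite_dimensional smul \<longleftrightarrow> (\<exists>S. finite S \<and> module.span smul S = UNIV)"

definition Der :: "(complex \<Rightarrow> 'a::comm_ring_1 \<Rightarrow> 'a) \<Rightarrow> ('a \<Rightarrow> 'a) set" where
  "Der smul =
     {d. Vector_Spaces.linear smul smul d \<and> (\<forall>a b. d (a * b) = d a * b + a * d b)}"

text \<open>
  With \<open>u, v\<close> in \<open>B\<close> and \<open>a\<close> in \<open>A\<close>: \<open>act a v\<close> is \<open>a \<cdot> v\<close>, \<open>bracket u v\<close> is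
  \<open>u\<^sub>0 v\<close>, \<open>der u a\<close> is \<open>u\<^sub>0 a\<close>, \<open>pairing u v\<close> is \<open>u\<^sub>1 v\<close>,
  and \<open>d\<close> is \<open>\<partial>\<close>.
\<close>

locale vertex_algebroid =
  A: comm_algebra sA + B: left_leibniz_algebra sB bracket
  for sA :: "complex \<Rightarrow> 'a::comm_ring_1 \<Rightarrow> 'a"
    and sB :: "complex \<Rightarrow> 'b::ab_group_add \<Rightarrow> 'b"
    and bracket :: "'b \<Rightarrow> 'b \<Rightarrow> 'b" +
  fixes act :: "'a \<Rightarrow> 'b \<Rightarrow> 'b"
    and der :: "'b \<Rightarrow> 'a \<Rightarrow> 'a"
    and pairing :: "'b \<Rightarrow> 'b \<Rightarrow> 'a"
    and d :: "'a \<Rightarrow> 'b"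
  assumes bilinear_act: "bilinear_map sA sB sB act"
    and act_one: "act 1 v = v"
    and der_Der: "der u \<in> Der sA"
    and der_add: "der (u + v) a = der u a + der v a"
    and der_scale: "der (sB c u) a = sA c (der u a)"
    and der_bracket: "der (bracket u v) a = der u (der v a) - der v (der u a)"
    and bilinear_pairing: "bilinear_map sB sB sA pairing"
    and pairing_sym: "pairing u v = pairing v u"
    and linear_partial: "Vector_Spaces.linear sA sB d"
    and der_partial: "der (d a) a' = 0"
    and act_act: "act a (act a' v) - act (a * a') v = act (der v a) (d a') + act (der v a') (d a)"
    and bracket_act: "bracket u (act a v) = act (der u a) v + act a (bracket u v)"
    and bracket_sym: "bracket u v + bracket v u = d (pairing u v)"
    and der_act: "der (act a v) a' = a * der v a'"
    and pairing_act: "pairing (act a u) v = a * pairing u v - der u (der v a)"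
    and der_pairing:
      "der v (pairing v1 v2) = pairing (bracket v v1) v2 + pairing v1 (bracket v v2)"
    and partial_mult: "d (a * a') = act a (d a') + act a' (d a)"
    and bracket_partial: "bracket v (d a) = d (der v a)"
    and pairing_partial: "pairing v (d a) = der v a"

text \<open>
  Submodules of a module on which the Lie algebra \<open>L\<close> acts through \<open>\<rho>\<close>.
\<close>

definition lie_submodule ::
  "(complex \<Rightarrow> 'a::ab_group_add \<Rightarrow> 'a) \<Rightarrow> 'b set \<Rightarrow> ('b \<Rightarrow> 'a \<Rightarrow> 'a) \<Rightarrow> 'a set \<Rightarrow> bool" where
  "lie_submodule smul L \<rho> M \<longleftrightarrow>
     module.subspace smul M \<and> (\<forall>x\<in>L. \<forall>a\<in>M. \<rho> x a \<in> M)"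

definition irreducible_lie_submodule ::
  "(complex \<Rightarrow> 'a::ab_group_add \<Rightarrow> 'a) \<Rightarrow> 'b set \<Rightarrow> ('b \<Rightarrow> 'a \<Rightarrow> 'a) \<Rightarrow> 'a set \<Rightarrow> bool" where
  "irreducible_lie_submodule smul L \<rho> M \<longleftrightarrow>
     lie_submodule smul L \<rho> M \<and> M \<noteq> {0} \<and>
     (\<forall>M'. lie_submodule smul L \<rho> M' \<and> M' \<subseteq> M \<longrightarrow> M' = {0} \<or> M' = M)"

definition highest_weight_vector ::
  "(complex \<Rightarrow> 'a::ab_group_add \<Rightarrow> 'a) \<Rightarrow> ('b \<Rightarrow> 'a \<Rightarrow> 'a) \<Rightarrow> 'b \<Rightarrow> 'b \<Rightarrow> 'a set \<Rightarrow> complex \<Rightarrow> 'a \<Rightarrow> bool"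
  where
  "highest_weight_vector smul \<rho> e h M \<mu> v \<longleftrightarrow>
     v \<in> M \<and> v \<noteq> 0 \<and> \<rho> e v = 0 \<and> \<rho> h v = smul \<mu> v"

definition subspace_sum :: "'i set \<Rightarrow> ('i \<Rightarrow> 'a::ab_group_add set) \<Rightarrow> 'a set" where
  "subspace_sum I M = {(\<Sum>i\<in>I. x i) | x. \<forall>i\<in>I. x i \<in> M i}"

definition is_direct_sum ::
  "(complex \<Rightarrow> 'a::ab_group_add \<Rightarrow> 'a) \<Rightarrow> 'i set \<Rightarrow> ('i \<Rightarrow> 'a set) \<Rightarrow> 'a set \<Rightarrow> bool" where
  "is_direct_sum smul I M V \<longleftrightarrow>
     finite I \<and> (\<forall>i\<in>I. module.subspace smul (M i)) \<and> V = subspace_sum I M \<and>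
     (\<forall>x. (\<forall>i\<in>I. x i \<in> M i) \<and> (\<Sum>i\<in>I. x i) = 0 \<longrightarrow> (\<forall>i\<in>I. x i = 0))"

text \<open>Ideals of a commutative ring are its submodules as a module over itself.\<close>

definition maximal_ideal :: "'a::comm_ring_1 set \<Rightarrow> bool" where
  "maximal_ideal M \<longleftrightarrow>
     module.subspace (*) M \<and> M \<noteq> UNIV \<and>
     (\<forall>J. module.subspace (*) J \<and> M \<subseteq> J \<longrightarrow> J = M \<or> J = UNIV)"

definition local_algebra :: "'a::comm_ring_1 itself \<Rightarrow> bool" where
  "local_algebra _ \<longleftrightarrow> (\<exists>!M::'a set. maximal_ideal M)"

end

theory Submission
  imports Defs
begin

text \<open>
  The axiom for \<open>(a \<cdot> u)\<^sub>1 v\<close>, read with \<open>a \<cdot> u = \<partial> x\<close>, determines \<open>v\<^sub>0 x\<close> for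
  \<open>v = e, f, h\<close>.  For a highest weight vector \<open>a\<close> of weight \<open>m\<close>, the \<open>sl\<^sub>2\<close> relations on the
  \<open>x\<close> obtained from \<open>a \<cdot> e\<close> force \<open>m = k\<close>; on the \<open>y\<close> obtained from \<open>a \<cdot> f\<close> they then force
  \<open>k = 1\<close> and \<open>f\<^sub>0 f\<^sub>0 a = 0\<close>.  So every \<open>N\<^sup>i\<close> is two-dimensional, the invariants of \<open>A\<close> are
  \<open>\<complex>1\<close>, and \<open>\<partial>\<close> kills exactly these.  Two elements of \<open>A\<close> with the same images under
  \<open>e, f, h\<close> thus have the same image under \<open>\<partial>\<close>, which gives \<open>a \<cdot> v = \<partial> (v\<^sub>0 a)\<close> on \<open>N\<close>.
  Finally \<open>0 = (\<partial> (v\<^sub>0 a))\<^sub>0 a' = (a \<cdot> v)\<^sub>0 a' = a * v\<^sub>0 a'\<close>, whence \<open>N * N = 0\<close>.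
\<close>

section \<open>Linearity and first consequences of the vertex algebroid axioms\<close>

context vertex_algebroid
begin

sublocale B: vector_space sB
  using linear_partial by (simp add: Vector_Spaces.linear_def)

lemma linear_d: "module_hom sA sB d"
  using linear_partial by (simp add: Vector_Spaces.linear_def)

lemma linear_der: "module_hom sA sA (der u)"
  using der_Der by (simp add: Der_def Vector_Spaces.linear_def)

lemma linear_pairing: "module_hom sB sA (pairing u)"
  using bilinear_pairing by (simp add: bilinear_map_def Vector_Spaces.linear_def)

lemma bracket_add:
  "bracket (u + v) x = bracket u x + bracket v x" "bracket x (u + v) = bracket x u + bracket x v"
  using B.bilinear_bracket
  by (auto simp: bilinear_map_def Vector_Spaces.linear_def dest: module_hom.add)

lemmas d_simps = module_hom.zero[OF linear_d] module_hom.add[OF linear_d]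
  module_hom.diff[OF linear_d] module_hom.neg[OF linear_d] module_hom.scale[OF linear_d]

lemmas der_simps = module_hom.zero[OF linear_der] module_hom.add[OF linear_der]
  module_hom.diff[OF linear_der] module_hom.neg[OF linear_der] module_hom.scale[OF linear_der]

lemmas pairing_simps = module_hom.zero[OF linear_pairing] module_hom.add[OF linear_pairing]
  module_hom.diff[OF linear_pairing] module_hom.neg[OF linear_pairing]
  module_hom.scale[OF linear_pairing]

lemma scale_mult_right: "x * sA c y = sA c (x * y)"
  using A.scale_mult_left[of c y x] by (simp add: mult.commute)

lemma der_one: "der u 1 = 0"
proof -
  have "der u (1 * 1) = der u 1 * 1 + 1 * der u 1"
    using der_Der[of u] unfolding Der_def by blast
  then show ?thesis by simp
qed

lemma d_one: "d 1 = 0"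
  using partial_mult[of 1 1] by (simp add: act_one)

lemma d_eq_0_imp_der_eq_0: "d x = 0 \<Longrightarrow> der v x = 0"
  using pairing_partial[of v x] by (simp add: pairing_simps)

text \<open>Both sides are the pairing of \<open>act a u\<close> with \<open>v\<close>, computed
  once from \<open>d x\<close> and once by \<open>pairing_act\<close>. This converts membership in
  \<open>range d\<close> into equations inside \<open>A\<close>.\<close>

lemma der_of_act_eq_d: "act a u = d x \<Longrightarrow> der v x = a * pairing u v - der u (der v a)"
  by (metis pairing_act pairing_partial pairing_sym)

text \<open>Submodule conditions range over the whole span of \<open>e\<close>, \<open>f\<close>,
  \<open>h\<close>. As \<open>der u x\<close> is linear in \<open>u\<close>, checking generators
  suffices.\<close>

lemma der_span_closed:
  assumes "u \<in> B.span S" "A.subspace M" "\<And>v. v \<in> S \<Longrightarrow> der v x \<in> M"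
  shows "der u x \<in> M"
  using assms(1)
proof (induction rule: B.span_induct_alt)
  case base
  have "der 0 x = 0" using der_scale[of 0 0 x] by simp
  then show ?case using assms(2) A.subspace_0 by simp
next
  case (step c y z)
  then show ?case
    using assms(2,3) by (simp add: der_add der_scale A.subspace_add A.subspace_scale)
qed

end

section \<open>The copy of sl2 and its invariant pairing\<close>

locale sl2_vertex_algebroid = vertex_algebroid +
  fixes e f h :: 'b and k :: complex
  assumes ef: "bracket e f = h" and he: "bracket h e = sB 2 e" and hf: "bracket h f = sB (-2) f"
    and lie: "lie_algebra_on sB bracket (B.span {e, f, h})"
    and pairing_ef: "pairing e f = sA k 1"
begin

lemma bracket_self:
  assumes "x \<in> B.span {e, f, h}"
  shows "bracket x x = 0"
  using lie assms unfolding lie_algebra_on_def by - (elim conjE, erule bspec, assumption)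

text \<open>Polarisation of \<open>bracket_self\<close> at \<open>x + y\<close>; the ambient bracket
  is only Leibniz.\<close>

lemma bracket_antisym:
  assumes "x \<in> {e, f, h}" "y \<in> {e, f, h}"
  shows "bracket x y = - bracket y x"
proof -
  have x: "x \<in> B.span {e, f, h}" and y: "y \<in> B.span {e, f, h}"
    using assms by (auto intro: B.span_base)
  then have "x + y \<in> B.span {e, f, h}" by (rule B.span_add)
  then have "bracket (x + y) (x + y) = 0" by (rule bracket_self)
  then show ?thesis
    by (simp add: bracket_add bracket_self x y eq_neg_iff_add_eq_0 add.commute)
qed

text \<open>Derivations kill the constant \<open>pairing e f\<close>, so invariance of the pairing
  propagates from it to all other pairs. The result is \<open>k\<close> times the trace form of 2 by
  2 matrices.\<close>

lemma pairing_e: "pairing e e = 0" "pairing e h = 0"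
  and pairing_f: "pairing f f = 0" "pairing f h = 0"
  and pairing_hh: "pairing h h = sA (2 * k) 1"
proof -
  have ff: "bracket f f = 0" and ee: "bracket e e = 0" by (simp_all add: bracket_self B.span_base)
  have fe: "bracket f e = - h" and eh: "bracket e h = sB (-2) e"
    and fh: "bracket f h = sB 2 f"
    using bracket_antisym[of f e] bracket_antisym[of e h] bracket_antisym[of f h] ef he hf by auto
  have der0: "der u (pairing e f) = 0" for u
    by (simp add: pairing_ef der_simps der_one)
  have z: "pairing 0 v = 0" for v
    using pairing_sym[of 0 v] by (simp add: pairing_simps)
  show peh: "pairing e h = 0"
    using der_pairing[of e e f] by (simp add: der0 ee ef z)
  have "pairing e (sB (-2) e) = 0"
    using der_pairing[of e e h] by (simp add: peh der_simps ee eh z)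
  then show "pairing e e = 0" by (simp add: pairing_simps)
  have "pairing (- h) f = 0"
    using der_pairing[of f e f] by (simp add: der0 ff fe pairing_simps)
  then show pfh: "pairing f h = 0"
    by (simp add: pairing_sym[of "- h" f] pairing_simps)
  have "pairing f (sB 2 f) = 0"
    using der_pairing[of f f h] by (simp add: pfh der_simps ff fh z)
  then show "pairing f f = 0" by (simp add: pairing_simps)
  have "pairing h h + pairing f (sB (-2) e) = 0"
    using der_pairing[of e f h] by (simp add: pfh der_simps ef eh)
  then show "pairing h h = sA (2 * k) 1"
    by (simp add: pairing_simps pairing_sym[of f e] pairing_ef)
qed

lemma mult_pairing:
  "a * pairing e e = 0" "a * pairing e f = sA k a" "a * pairing e h = 0"
  "a * pairing f e = sA k a" "a * pairing f f = 0" "a * pairing f h = 0"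
  "a * pairing h e = 0" "a * pairing h f = 0" "a * pairing h h = sA (2 * k) a"
  using pairing_sym[of f e] pairing_sym[of h e] pairing_sym[of h f]
  by (auto simp: pairing_e pairing_f pairing_hh pairing_ef scale_mult_right)

lemma der_h: "der h x = der e (der f x) - der f (der e x)"
  using der_bracket[of e f x] by (simp add: ef)

lemma der_hf: "der h (der f x) = der f (der h x) - sA 2 (der f x)"
  using der_bracket[of h f x] unfolding hf der_scale by (simp add: algebra_simps)

section \<open>Highest weights and the level\<close>

lemma highest_weight_eq_level:
  assumes hw: "der e a = 0" "der h a = sA \<mu> a" and "a \<noteq> 0" and "\<mu> + 2 \<noteq> 0"
    and range: "act a e \<in> range d"
  shows "\<mu> = k"
proof -
  obtain x where x: "act a e = d x" using range by auto
  have fx: "der f x = sA (k - \<mu>) a"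
    using der_of_act_eq_d[OF x, of f] der_h[of a] hw
    by (simp add: mult_pairing der_simps A.scale_left_diff_distrib)
  have hx: "der h x = 0"
    using der_of_act_eq_d[OF x, of h] hw by (simp add: mult_pairing der_simps)
  \<comment> \<open>The relation [h,f] = -2f evaluated at \<open>x\<close>: \<open>der f x\<close>
    has weight \<mu>, while \<open>der h x\<close> vanishes.\<close>
  have "sA ((k - \<mu>) * \<mu>) a = - sA (2 * (k - \<mu>)) a"
    using der_hf[of x] by (simp add: fx hx hw der_simps)
  then have "sA ((k - \<mu>) * (\<mu> + 2)) a = 0"
    by (simp add: algebra_simps)
  then show ?thesis using assms by simp
qed

lemma level_one:
  assumes hw: "der e a = 0" "der h a = sA k a" and "a \<noteq> 0" and "k \<noteq> 0"
    and range: "act a f \<in> range d"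
  shows "k = 1" and "der f (der f a) = 0"
proof -
  obtain y where y: "act a f = d y" using range by auto
  let ?b = "der f a"
  have eb: "der e ?b = sA k a" using der_h[of a] hw by (simp add: der_simps)
  then have b: "?b \<noteq> 0" using assms by (auto simp: der_simps)
  have hb: "der h ?b = sA (k - 2) ?b"
    using der_hf[of a] by (simp add: hw der_simps A.scale_left_diff_distrib)
  have efb: "der e (der f ?b) = sA (2 * k - 2) ?b"
    using der_h[of ?b] by (simp add: eb hb der_simps algebra_simps flip: A.scale_left_distrib)
  have hfb: "der h (der f ?b) = sA (k - 4) (der f ?b)"
    using der_hf[of ?b] by (simp add: hb der_simps flip: A.scale_left_diff_distrib)
  have ey: "der e y = sA k a"
    using der_of_act_eq_d[OF y, of e] hw by (simp add: mult_pairing der_simps)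
  have fy: "der f y = - der f ?b"
    using der_of_act_eq_d[OF y, of f] by (simp add: mult_pairing)
  have hy: "der h y = - sA k ?b"
    using der_of_act_eq_d[OF y, of h] hw by (simp add: mult_pairing der_simps)
  \<comment> \<open>The relation [e,f] = h evaluated at \<open>y\<close>; the terms in
    \<open>sA k ?b\<close> cancel.\<close>
  have "sA (2 * k - 2) ?b = 0"
    using der_h[of y] by (simp add: ey fy hy der_simps efb)
  then show k: "k = 1" using b by simp
  \<comment> \<open>The relation [h,f] = -2f at \<open>y\<close> assigns \<open>der f ?b\<close> the
    factor k - 2, but its weight is k - 4, so it must vanish.\<close>
  have "- sA (k - 4) (der f ?b) = - (sA (k - 2) (der f ?b))"
    using der_hf[of y] by (simp add: fy hy der_simps hfb A.scale_left_diff_distrib)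
  then have "sA (k - 4) (der f ?b) = sA (k - 2) (der f ?b)"
    by (simp only: neg_equal_iff_equal)
  then show "der f ?b = 0"
    using A.scale_right_imp_eq[of "der f ?b" "k - 4" "k - 2"] by auto
qed

section \<open>Two-dimensional representations through anticommutators\<close>

text \<open>The quadratic relations that hold in the two-dimensional irreducible representation.\<close>

definition doublet :: "'a set" where
  "doublet = {x. der e (der e x) = 0 \<and> der f (der f x) = 0 \<and>
     der e (der f x) + der f (der e x) = x \<and> der h (der h x) = x \<and>
     der e (der h x) + der h (der e x) = 0 \<and> der f (der h x) + der h (der f x) = 0}"

lemma subspace_doublet: "A.subspace doublet"
proof (rule A.subspaceI)
  show "0 \<in> doublet" by (simp add: doublet_def der_simps)
  show "x + y \<in> doublet" if "x \<in> doublet" "y \<in> doublet" for x y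
  proof -
    have "der e (der f (x + y)) + der f (der e (x + y))
        = (der e (der f x) + der f (der e x)) + (der e (der f y) + der f (der e y))"
      "der e (der h (x + y)) + der h (der e (x + y))
        = (der e (der h x) + der h (der e x)) + (der e (der h y) + der h (der e y))"
      "der f (der h (x + y)) + der h (der f (x + y))
        = (der f (der h x) + der h (der f x)) + (der f (der h y) + der h (der f y))"
      by (simp_all add: der_simps)
    then show ?thesis using that
      unfolding doublet_def mem_Collect_eq by (simp only: der_simps(2) add_0_left simp_thms)
  qed
  show "sA c x \<in> doublet" if "x \<in> doublet" for c x
    using that by (simp add: doublet_def der_simps flip: A.scale_right_distrib)
qed

lemma highest_weight_doublet:
  assumes "der e a = 0" "der h a = a" "der f (der f a) = 0"
  shows "der e (der f a) = a" "der h (der f a) = - der f a"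
    and "a \<in> doublet" "der f a \<in> doublet"
proof -
  show ef: "der e (der f a) = a"
    using der_h[of a] assms by (simp add: der_simps)
  have "sA 2 (der f a) = der f a + der f a"
    using A.scale_left_distrib[of 1 1 "der f a"] by simp
  then show hf: "der h (der f a) = - der f a"
    using der_hf[of a] assms by simp
  show "a \<in> doublet" "der f a \<in> doublet"
    by (simp_all add: doublet_def assms ef hf der_simps)
qed

text \<open>For \<open>k = 1\<close>, the relations of \<open>doublet\<close> say that the
  anticommutator of \<open>der u\<close> and \<open>der v\<close> acts as the scalar given by
  \<open>pairing u v\<close>. If \<open>act a u = d x\<close>, then \<open>der_of_act_eq_d\<close>
  turns this into \<open>der v x = der v (der u a)\<close>, so \<open>x - der u a\<close> is
  invariant and \<open>d\<close> kills it.\<close>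

lemma act_doublet:
  assumes inv: "\<And>x. \<forall>v\<in>{e, f, h}. der v x = 0 \<Longrightarrow> d x = 0"
    and "k = 1" and a: "a \<in> doublet" and u: "u \<in> {e, f, h}" and range: "act a u \<in> range d"
  shows "act a u = d (der u a)"
proof -
  obtain x where x: "act a u = d x" using range by auto
  have two: "sA 2 a = a + a"
    using A.scale_left_distrib[of 1 1 a] by simp
  have "der e (der f a) = a - der f (der e a)" "der e (der h a) = - der h (der e a)"
    "der f (der h a) = - der h (der f a)"
    using a unfolding doublet_def by (auto simp: eq_diff_eq eq_neg_iff_add_eq_0)
  then have "\<forall>v\<in>{e, f, h}. der v (x - der u a) = 0"
    using u a der_of_act_eq_d[OF x] \<open>k = 1\<close>
    by (auto simp: der_simps mult_pairing doublet_def two)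
  then have "d (x - der u a) = 0" by (rule inv)
  then show ?thesis by (simp add: d_simps x)
qed

end

section \<open>Sums of subspaces and a criterion for local rings\<close>

lemma (in comm_algebra) subspace_subspace_sum:
  assumes "\<And>i. i \<in> I \<Longrightarrow> subspace (N i)"
  shows "subspace (subspace_sum I N)"
proof (rule subspaceI)
  have "(\<Sum>i\<in>I. 0) \<in> subspace_sum I N"
    unfolding subspace_sum_def by (rule CollectI, rule exI[of _ "\<lambda>_. 0"]) (simp add: assms subspace_0)
  then show "0 \<in> subspace_sum I N" by simp
next
  fix x y assume "x \<in> subspace_sum I N" "y \<in> subspace_sum I N"
  then obtain p q where p: "x = sum p I" "\<forall>i\<in>I. p i \<in> N i"
    and q: "y = sum q I" "\<forall>i\<in>I. q i \<in> N i"
    unfolding subspace_sum_def by blast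
  have "(\<Sum>i\<in>I. p i + q i) \<in> subspace_sum I N"
    unfolding subspace_sum_def
    by (rule CollectI, rule exI[of _ "\<lambda>i. p i + q i"]) (simp add: assms subspace_add p q)
  then show "x + y \<in> subspace_sum I N" by (simp add: p q sum.distrib)
next
  fix c x assume "x \<in> subspace_sum I N"
  then obtain p where p: "x = sum p I" "\<forall>i\<in>I. p i \<in> N i"
    unfolding subspace_sum_def by blast
  have "(\<Sum>i\<in>I. smul c (p i)) \<in> subspace_sum I N"
    unfolding subspace_sum_def
    by (rule CollectI, rule exI[of _ "\<lambda>i. smul c (p i)"]) (simp add: assms subspace_scale p)
  then show "smul c x \<in> subspace_sum I N" by (simp add: p scale_sum_right)
qed

lemma (in comm_algebra) subspace_sum_subset:
  assumes "subspace M" "\<And>i. i \<in> I \<Longrightarrow> N i \<subseteq> M"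
  shows "subspace_sum I N \<subseteq> M"
proof
  fix x assume "x \<in> subspace_sum I N"
  then obtain p where p: "x = sum p I" "\<forall>i\<in>I. p i \<in> N i"
    unfolding subspace_sum_def by blast
  then show "x \<in> M" using assms(2) by (auto intro!: subspace_sum[OF assms(1)])
qed

lemma subset_subspace_sum:
  assumes "finite I" "i \<in> I" "\<And>j. j \<in> I \<Longrightarrow> 0 \<in> N j"
  shows "N i \<subseteq> subspace_sum I N"
proof
  fix x assume "x \<in> N i"
  then have "\<forall>j\<in>I. (if j = i then x else 0) \<in> N j" using assms(3) by simp
  moreover have "(\<Sum>j\<in>I. if j = i then x else 0) = x" using assms(1,2) by simp
  ultimately show "x \<in> subspace_sum I N"
    unfolding subspace_sum_def by (intro CollectI exI[of _ "\<lambda>j. if j = i then x else 0"]) simp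
qed

text \<open>A proper ideal contains no unit, hence lies inside \<open>M\<close>; so \<open>M\<close>
  is the only maximal ideal.\<close>

lemma local_algebra_if_nonunits_subset:
  fixes M :: "'a::comm_ring_1 set"
  assumes M: "module.subspace (*) M" and "1 \<notin> M" and unit: "\<And>x. x \<notin> M \<Longrightarrow> x dvd 1"
  shows "local_algebra TYPE('a)"
proof -
  interpret module "(*) :: 'a \<Rightarrow> 'a \<Rightarrow> 'a"
    by unfold_locales (simp_all add: algebra_simps)
  have proper: "J \<subseteq> M" if J: "subspace J" "J \<noteq> UNIV" for J
  proof
    fix x assume x: "x \<in> J"
    show "x \<in> M"
    proof (rule ccontr)
      assume "x \<notin> M"
      then obtain y where "1 = x * y" using unit unfolding dvd_def by blast
      then have "1 \<in> J" using subspace_scale[OF J(1) x, of y] by (simp add: mult.commute)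
      then have "z \<in> J" for z using subspace_scale[OF J(1), of 1 z] by simp
      then show False using J(2) by auto
    qed
  qed
  have max: "maximal_ideal M"
    unfolding maximal_ideal_def using M \<open>1 \<notin> M\<close> proper by blast
  have "J = M" if "maximal_ideal J" for J
    using that M \<open>1 \<notin> M\<close> proper unfolding maximal_ideal_def by blast
  then show ?thesis
    unfolding local_algebra_def using max by blast
qed

section \<open>The structure of \<open>A\<close> from its decomposition\<close>

locale sl2_decomposed_vertex_algebroid = sl2_vertex_algebroid +
  fixes t :: nat and N :: "nat \<Rightarrow> 'a set" and m :: "nat \<Rightarrow> nat" and w :: "nat \<Rightarrow> 'a"
  assumes k_nonzero: "k \<noteq> 0" and t_pos: "t \<ge> 1"
    and decomposition: "subspace_sum {0..t} (N(0 := A.span {1})) = UNIV"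
    and irreducible: "i \<in> {1..t} \<Longrightarrow> irreducible_lie_submodule sA (B.span {e, f, h}) der (N i)"
    and act_range: "x \<in> subspace_sum {1..t} N \<Longrightarrow> act x b \<in> range d"
    and highest_weight: "i \<in> {1..t} \<Longrightarrow> highest_weight_vector sA der e h (N i) (of_nat (m i)) (w i)"
begin

abbreviation NN :: "'a set" where "NN \<equiv> subspace_sum {1..t} N"

lemma N_submodule:
  assumes "i \<in> {1..t}"
  shows "A.subspace (N i)" and "u \<in> {e, f, h} \<Longrightarrow> x \<in> N i \<Longrightarrow> der u x \<in> N i"
  using irreducible[OF assms] B.span_base[of u "{e, f, h}"]
  unfolding irreducible_lie_submodule_def lie_submodule_def by auto

lemma subspace_NN: "A.subspace NN"
  using N_submodule(1) by (rule A.subspace_subspace_sum)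

lemma N_subset_NN: "i \<in> {1..t} \<Longrightarrow> N i \<subseteq> NN"
  using N_submodule(1) A.subspace_0 by (intro subset_subspace_sum) auto

lemma highest_weight_w:
  assumes "i \<in> {1..t}"
  shows "w i \<in> N i" "w i \<noteq> 0" "der e (w i) = 0" "der h (w i) = sA (of_nat (m i)) (w i)"
  using highest_weight[OF assms] by (simp_all add: highest_weight_vector_def)

lemma k_eq_m:
  assumes i: "i \<in> {1..t}"
  shows "k = of_nat (m i)"
proof -
  have "w i \<in> NN" using highest_weight_w(1) N_subset_NN i by blast
  \<comment> \<open>A natural weight avoids the exceptional value -2 of
    \<open>highest_weight_eq_level\<close>.\<close>
  moreover have "complex_of_nat (m i) + 2 \<noteq> 0"
    using of_nat_eq_0_iff[of "m i + 2", where 'a = complex] by (simp add: add.commute)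
  ultimately show ?thesis
    using highest_weight_eq_level[OF highest_weight_w(3,4,2)[OF i]] act_range by simp
qed

lemma ff_w: "i \<in> {1..t} \<Longrightarrow> der f (der f (w i)) = 0"
  and k_eq_1: "k = 1"
proof -
  have *: "k = 1 \<and> der f (der f (w i)) = 0" if i: "i \<in> {1..t}" for i
  proof -
    have "w i \<in> NN" using highest_weight_w(1) N_subset_NN i by blast
    then show ?thesis
      using level_one[OF highest_weight_w(3)[OF i] _ highest_weight_w(2)[OF i] k_nonzero] highest_weight_w(4)[OF i] k_eq_m[OF i] act_range
      by simp
  qed
  then show "i \<in> {1..t} \<Longrightarrow> der f (der f (w i)) = 0" by blast
  \<comment> \<open>The value of \<open>k\<close> is read off from one summand, which exists because
    \<open>t\<close> is positive.\<close>
  show "k = 1" using *[of 1] t_pos by simp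
qed

lemma m_eq_1: "i \<in> {1..t} \<Longrightarrow> m i = 1"
  using k_eq_m k_eq_1 of_nat_eq_iff[of "m i" 1, where 'a = complex] by simp

lemma h_w: "i \<in> {1..t} \<Longrightarrow> der h (w i) = w i"
  using highest_weight_w(4) m_eq_1 by simp

lemmas w_doublet = highest_weight_doublet[OF highest_weight_w(3) h_w ff_w]

text \<open>The two vectors span a nonzero submodule of the irreducible \<open>N i\<close>.\<close>

lemma N_eq_span:
  assumes i: "i \<in> {1..t}"
  shows "N i = A.span {w i, der f (w i)}"
proof -
  let ?S = "{w i, der f (w i)}"
  have sub: "A.span ?S \<subseteq> N i"
    using highest_weight_w(1)[OF i] N_submodule[OF i] by (intro A.span_minimal) auto
  have "der u x \<in> A.span ?S" if "x \<in> A.span ?S" "u \<in> {e, f, h}" for u x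
    using that(1)
  proof (induction rule: A.span_induct_alt)
    case base
    then show ?case by (simp add: der_simps A.span_zero)
  next
    case (step c x y)
    have "der u x \<in> A.span ?S"
      using step(1) that(2) highest_weight_w(3)[OF i] h_w[OF i] ff_w[OF i] w_doublet(1,2)[OF i i i]
      by (auto simp: A.span_zero A.span_base A.span_neg)
    then show ?case using step(2) by (simp add: der_simps A.span_add A.span_scale)
  qed
  then have "lie_submodule sA (B.span {e, f, h}) der (A.span ?S)"
    unfolding lie_submodule_def using der_span_closed by (blast intro: A.subspace_span)
  moreover have "A.span ?S \<noteq> {0}"
    using highest_weight_w(2)[OF i] A.span_base[of "w i" ?S] by auto
  ultimately show ?thesis
    using irreducible[OF i] sub unfolding irreducible_lie_submodule_def by blast
qed

lemma dim_N:
  assumes i: "i \<in> {1..t}"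
  shows "A.dim (N i) = 2"
proof -
  note b = w_doublet(1,2)[OF i i i]
  \<comment> \<open>Applying \<open>der f\<close> to a relation
    \<open>w i = sA c (der f (w i))\<close> gives \<open>der f (w i) = 0\<close> by
    \<open>ff_w\<close>, and then \<open>w i = 0\<close>.\<close>
  have notin: "w i \<notin> A.span {der f (w i)}"
  proof
    assume "w i \<in> A.span {der f (w i)}"
    then obtain c where c: "w i = sA c (der f (w i))" by (auto simp: A.span_singleton)
    then have "der f (w i) = sA c (der f (der f (w i)))" by (metis der_simps(5))
    then have "der f (w i) = 0" by (simp add: ff_w[OF i])
    then show False using c highest_weight_w(2)[OF i] by simp
  qed
  have fw: "der f (w i) \<noteq> 0" using b highest_weight_w(2)[OF i] by (auto simp: der_simps)
  have neq: "w i \<noteq> der f (w i)" using notin A.span_base by auto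
  have "A.independent {w i, der f (w i)}"
    using notin neq fw by (simp add: A.independent_insert)
  then show ?thesis
    using neq by (simp add: N_eq_span[OF i] A.dim_eq_card_independent)
qed

text \<open>The relations are linear, so it is enough to have them on the spanning vectors. Later
  arguments can thus treat elements of \<open>NN\<close> without bases.\<close>

lemma NN_subset_doublet: "NN \<subseteq> doublet"
proof (rule A.subspace_sum_subset[OF subspace_doublet])
  fix i assume i: "i \<in> {1..t}"
  then show "N i \<subseteq> doublet"
    using w_doublet(3,4)[OF i i i] by (simp add: N_eq_span A.span_minimal subspace_doublet)
qed

lemma decompose: obtains c n where "n \<in> NN" "z = sA c 1 + n"
proof -
  have "z \<in> subspace_sum {0..t} (N(0 := A.span {1}))" using decomposition by simp
  then obtain p where p: "z = sum p {0..t}" "\<forall>i\<in>{0..t}. p i \<in> (N(0 := A.span {1})) i"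
    unfolding subspace_sum_def by auto
  \<comment> \<open>Index 0 carries the trivial summand; the remaining indices contribute the part
    in \<open>NN\<close>.\<close>
  have "p 0 \<in> A.span {1}" using p(2) by (auto dest: bspec[of _ _ 0])
  then obtain c where c: "p 0 = sA c 1" by (auto simp: A.span_singleton)
  have "z = p 0 + sum p {1..t}"
    using p(1) by (simp add: sum.atLeast_Suc_atMost)
  moreover have "sum p {1..t} \<in> NN"
    unfolding subspace_sum_def using p(2) by (force dest: bspec)
  ultimately show ?thesis using that c by simp
qed

text \<open>The component in \<open>NN\<close> is also invariant, and the anticommutator of
  \<open>der e\<close> and \<open>der f\<close> is the identity on \<open>NN\<close>, so that
  component is zero.\<close>

lemma invariant_in_span_one:
  assumes "\<forall>v\<in>{e, f, h}. der v x = 0"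
  shows "x \<in> A.span {1}"
proof -
  obtain c n where n: "n \<in> NN" and x: "x = sA c 1 + n" by (rule decompose)
  then have "\<forall>v\<in>{e, f, h}. der v n = 0" using assms by (simp add: der_simps der_one)
  moreover have "der e (der f n) + der f (der e n) = n"
    using n NN_subset_doublet by (auto simp: doublet_def)
  ultimately have "n = 0" by (simp add: der_simps)
  then show ?thesis using x by (simp add: A.span_base A.span_scale)
qed

lemma kernel_d: "{x. d x = 0} = A.span {1}"
  using invariant_in_span_one d_eq_0_imp_der_eq_0
  by (auto simp: A.span_singleton d_simps d_one)

lemma invariant_imp_d_eq_0: "\<forall>v\<in>{e, f, h}. der v x = 0 \<Longrightarrow> d x = 0"
  using invariant_in_span_one kernel_d by blast

lemma act_NN:
  assumes "x \<in> NN" "u \<in> {e, f, h}"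
  shows "act x u = d (der u x)"
  using act_doublet[OF invariant_imp_d_eq_0 k_eq_1 _ assms(2)] assms NN_subset_doublet act_range
  by blast

text \<open>By \<open>der_act\<close> the product is \<open>der (act x u) y\<close>, and
  \<open>act x u\<close> lies in \<open>range d\<close>, which acts on \<open>A\<close> by zero.
  Here \<open>y\<close> is any element of \<open>A\<close>.\<close>

lemma mult_der_eq_0:
  assumes "x \<in> NN" "u \<in> {e, f, h}"
  shows "x * der u y = 0"
  using der_act[of x u y] by (simp add: act_NN[OF assms] der_partial)

lemma mult_NN:
  assumes "x \<in> NN" "y \<in> NN"
  shows "x * y = 0"
proof -
  \<comment> \<open>Every element of \<open>NN\<close> is itself an image under
    \<open>der h\<close>, so \<open>mult_der_eq_0\<close> applies.\<close>
  have "der h (der h y) = y" using assms(2) NN_subset_doublet by (auto simp: doublet_def)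
  then show ?thesis using mult_der_eq_0[OF assms(1), of h "der h y"] by simp
qed

text \<open>For a preimage \<open>z\<close> of \<open>act x (d y)\<close> under \<open>d\<close>,
  \<open>der_of_act_eq_d\<close> reduces \<open>der v z\<close> to \<open>x * der v y\<close>, which
  is zero. So \<open>z\<close> is invariant and \<open>d z = 0\<close>.\<close>

lemma act_d_NN:
  assumes "x \<in> NN"
  shows "act x (d y) = 0"
proof -
  obtain z where z: "act x (d y) = d z" using act_range[OF assms] by blast
  have "der v z = 0" if "v \<in> {e, f, h}" for v
    using der_of_act_eq_d[OF z, of v] mult_der_eq_0[OF assms that] pairing_partial[of v y]
    by (simp add: pairing_sym[of "d y" v] der_partial)
  then show ?thesis using z invariant_imp_d_eq_0 by simp
qed

lemma local_A: "local_algebra TYPE('a)"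
proof (rule local_algebra_if_nonunits_subset[of NN])
  interpret M: module "(*) :: 'a \<Rightarrow> 'a \<Rightarrow> 'a"
    by unfold_locales (simp_all add: algebra_simps)
  show "M.subspace NN"
  proof (rule M.subspaceI)
    fix z x assume x: "x \<in> NN"
    obtain c n where "n \<in> NN" "z = sA c 1 + n" by (rule decompose)
    then have "z * x = sA c x"
      using mult_NN x by (simp add: distrib_right A.scale_mult_left)
    then show "z * x \<in> NN" using x A.subspace_scale[OF subspace_NN] by simp
  qed (rule A.subspace_0[OF subspace_NN], rule A.subspace_add[OF subspace_NN])
  \<comment> \<open>Elements of \<open>NN\<close> are fixed by the square of \<open>der h\<close>,
    which kills 1.\<close>
  show "1 \<notin> NN"
    using NN_subset_doublet by (auto simp: doublet_def der_one der_simps)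
  fix z assume z: "z \<notin> NN"
  obtain c n where n: "n \<in> NN" "z = sA c 1 + n" by (rule decompose)
  then have c: "c \<noteq> 0" using z by auto
  \<comment> \<open>The inverse is the geometric series of \<open>sA c 1 + n\<close>, truncated
    since \<open>n * n = 0\<close>.\<close>
  have "z * (sA (1 / c) 1 - sA (1 / c\<^sup>2) n) = 1"
    using c mult_NN[OF n(1) n(1)]
    by (simp add: n(2) algebra_simps A.scale_mult_left scale_mult_right power2_eq_square)
  then show "z dvd 1" by (metis dvd_triv_left)
qed

end

section \<open>The structure theorem in the bases \<open>a i 0\<close>, \<open>a i 1\<close>\<close>

theorem theorem7:
  fixes sA :: "complex \<Rightarrow> 'a::comm_ring_1 \<Rightarrow> 'a"
    and sB :: "complex \<Rightarrow> 'b::ab_group_add \<Rightarrow> 'b"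
    and bracket :: "'b \<Rightarrow> 'b \<Rightarrow> 'b"
    and act :: "'a \<Rightarrow> 'b \<Rightarrow> 'b"
    and der :: "'b \<Rightarrow> 'a \<Rightarrow> 'a"
    and pairing :: "'b \<Rightarrow> 'b \<Rightarrow> 'a"
    and d :: "'a \<Rightarrow> 'b"
    and e f h :: 'b
    and t :: nat
    and N :: "nat \<Rightarrow> 'a set"
    and NN :: "'a set"
    and m :: "nat \<Rightarrow> nat"
    and a :: "nat \<Rightarrow> int \<Rightarrow> 'a"
    and k :: complex
  assumes "vertex_algebroid sA sB bracket act der pairing d"
    and "finite_dimensional sA"
    and "vector_space.dim sA UNIV \<ge> 2"
    and "\<not> lie_algebra_on sB bracket UNIV"
    and "bracket e f = h"
    and "bracket h e = sB 2 e"
    and "bracket h f = sB (-2) f"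
    and "bracket h h = 0"
    and "lie_algebra_on sB bracket (module.span sB {e, f, h})"
    and "lie_isomorphic sB bracket (module.span sB {e, f, h}) matrix_scale matrix_commutator sl2"
    and "is_direct_sum sA {0..t} (N(0 := module.span sA {1})) UNIV"
    and "\<And>i. i \<in> {1..t} \<Longrightarrow>
           irreducible_lie_submodule sA (module.span sB {e, f, h}) der (N i)"
    and "NN = subspace_sum {1..t} N"
    and "module.span sB {act n b | n b. n \<in> NN} \<subseteq> range d"
    and "\<And>i. i \<in> {1..t} \<Longrightarrow> highest_weight_vector sA der e h (N i) (of_nat (m i)) (a i 0)"
    and "\<And>i (j::nat). i \<in> {1..t} \<Longrightarrow> j \<le> m i \<Longrightarrow>
           a i (int j) = sA (1 / fact j) ((der f ^^ j) (a i 0))"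
    and "\<And>i. i \<in> {1..t} \<Longrightarrow> a i (-1) = 0"
    and "\<And>i. i \<in> {1..t} \<Longrightarrow> a i (int (m i) + 1) = 0"
    and "pairing e f = sA k 1"
    and "k \<noteq> 0"
  shows "{x. d x = 0} = module.span sA {1} \<and>

    (\<forall>i\<in>{1..t}. irreducible_lie_submodule sA (module.span sB {e, f, h}) der (N i) \<and>
                 vector_space.dim sA (N i) = 2) \<and>
    local_algebra TYPE('a) \<and>
    (\<forall>i\<in>{1..t}. \<forall>j\<in>{1..t}. \<forall>s\<in>{0, 1}. \<forall>r\<in>{0, 1}.
       a i s * a j r = 0 \<and>
       act (a i 0) e = 0 \<and> act (a i 1) e = d (a i 0) \<and>
       act (a i 0) f = d (a i 1) \<and> act (a i 1) f = 0 \<and>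
       act (a i 0) h = d (a i 0) \<and> act (a i 1) h = - d (a i 1) \<and>
       act (a i s) (d (a j r)) = 0 \<and>
       pairing (d (a i s)) e = der e (a i s) \<and>
       der e (a i s) = sA (of_int (2 - s)) (a i (s - 1)) \<and>
       pairing (d (a i s)) f = der f (a i s) \<and>
       der f (a i s) = sA (of_int (s + 1)) (a i (s + 1)) \<and>
       pairing (d (a i s)) h = der h (a i s) \<and>
       der h (a i s) = sA (of_int (1 - 2 * s)) (a i s)) \<and>
    k = 1 \<and>

    (\<forall>x\<in>NN. \<forall>x'\<in>NN.
       act x e = d (der e x) \<and> act x f = d (der f x) \<and> act x h = d (der h x) \<and>
       act x (d x') = 0)"
proof -
  interpret vertex_algebroid sA sB bracket act der pairing d by fact
  \<comment> \<open>Without summands \<open>A\<close> would be the line spanned by 1, against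
    dimension at least 2.\<close>
  have t: "t \<ge> 1"
  proof (rule ccontr)
    assume "\<not> t \<ge> 1"
    then have "t = 0" by simp
    then have "subspace_sum {0} (N(0 := A.span {1})) = UNIV"
      using assms(11) by (simp add: is_direct_sum_def)
    moreover have "subspace_sum {0} (N(0 := A.span {1})) \<subseteq> A.span {1}"
      by (rule A.subspace_sum_subset) auto
    ultimately have "UNIV \<subseteq> A.span {1}" by simp
    then have "A.dim UNIV \<le> card {1 :: 'a}" by (rule A.dim_le_card) simp
    then show False using assms(3) by simp
  qed
  interpret sl2_decomposed_vertex_algebroid sA sB bracket act der pairing d e f h k t N m "\<lambda>i. a i 0"
  proof unfold_locales
    show "act x b \<in> range d" if "x \<in> subspace_sum {1..t} N" for x b
      using assms(14) B.span_base[of "act x b" "{act n b | n b. n \<in> NN}"] that assms(13) by blast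
    show "subspace_sum {0..t} (N(0 := A.span {1})) = UNIV"
      using assms(11) by (simp add: is_direct_sum_def)
  qed (use assms t in auto)
  have mem: "a i s \<in> subspace_sum {1..t} N" and der_a: "der e (a i s) = sA (of_int (2 - s)) (a i (s - 1))"
    "der f (a i s) = sA (of_int (s + 1)) (a i (s + 1))" "der h (a i s) = sA (of_int (1 - 2 * s)) (a i s)"
    if i: "i \<in> {1..t}" and s: "s \<in> {0, 1}" for i s
  proof -
    \<comment> \<open>With \<open>m i = 1\<close> the basis stops at \<open>a i 1\<close>, and the
      shifted indices in the formulas meet only the boundary values \<open>a i (-1)\<close> and
      \<open>a i 2\<close>, both zero.\<close>
    have m: "m i = 1" using m_eq_1[OF i] .
    have a1: "a i 1 = der f (a i 0)" using assms(16)[OF i, of 1] m by simp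
    have a2: "a i 2 = 0" using assms(18)[OF i] m by simp
    show "a i s \<in> subspace_sum {1..t} N"
      using s a1 highest_weight_w(1)[OF i] N_submodule(2)[OF i] N_subset_NN[OF i] by auto
    show "der e (a i s) = sA (of_int (2 - s)) (a i (s - 1))"
      "der f (a i s) = sA (of_int (s + 1)) (a i (s + 1))"
      "der h (a i s) = sA (of_int (1 - 2 * s)) (a i s)"
      using s a1 a2 assms(17)[OF i] highest_weight_w(3)[OF i] h_w[OF i] ff_w[OF i] w_doublet(1,2)[OF i i i]
      by auto
  qed
  have v: "a i (-1) = 0" "a i 2 = 0" if "i \<in> {1..t}" for i
    using assms(17)[OF that] assms(18)[OF that] m_eq_1[OF that] by simp_all
  \<comment> \<open>The table of actions is \<open>act x u = d (der u x)\<close> evaluated on the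
    basis; the pairings reduce to \<open>pairing_partial\<close> by symmetry.\<close>
  have "a i s * a j r = 0 \<and>
       act (a i 0) e = 0 \<and> act (a i 1) e = d (a i 0) \<and>
       act (a i 0) f = d (a i 1) \<and> act (a i 1) f = 0 \<and>
       act (a i 0) h = d (a i 0) \<and> act (a i 1) h = - d (a i 1) \<and>
       act (a i s) (d (a j r)) = 0 \<and>
       pairing (d (a i s)) e = der e (a i s) \<and>
       pairing (d (a i s)) f = der f (a i s) \<and>
       pairing (d (a i s)) h = der h (a i s)"
    if i: "i \<in> {1..t}" and j: "j \<in> {1..t}" and s: "s \<in> {0, 1}" and r: "r \<in> {0, 1}" for i j s r
    using mem[OF i, of 0] mem[OF i, of 1] mult_NN[OF mem[OF i s] mem[OF j r]] act_d_NN[OF mem[OF i s]]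
      der_a[OF i, of 0] der_a[OF i, of 1] v[OF i]
    by (simp add: act_NN d_simps pairing_sym[of "d (a i s)"] pairing_partial)
  then show ?thesis
    using kernel_d k_eq_1 local_A dim_N irreducible der_a act_NN act_d_NN assms(13) by auto
qed

end
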